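(* Suppose the counterfactual distribution $\mathrm{pr}(Y_0=\cdot\mid Z=1)$ is identifiable (so that both marginal distributions $\mathrm{pr}(Y_1=\cdot\mid Z=1)=\mathrm{pr}(Y=\cdot\mid Z=1)$ and $\mathrm{pr}(Y_0=\cdot\mid Z=1)$ are known). Let $\omega_0=\{Y_0\in S\}$ with $S\subseteq\{0,\ldots,J-1\}$ be an event depending only on $Y_0$, with indicators $c_\ell=1$ if $\ell\in S$ and $c_\ell=0$ otherwise. Then the sharp bounds on $\mathrm{PN}(\omega_0,y)=\mathrm{pr}(\omega_0\mid Z=1,Y=y)$ are $$\max\left(0,\ \frac{\mathrm{pr}(Y=y\mid Z=1)-\sum_{\ell=0}^{J-1}(1-c_\ell)\,\mathrm{pr}(Y_0=\ell\mid Z=1)}{\mathrm{pr}(Y=y\mid Z=1)}\right)\le \mathrm{PN}(\omega_0,y)\le \min\left(1,\ \frac{\sum_{\ell=0}^{J-1}c_\ell\,\mathrm{pr}(Y_0=\ell\mid Z=1)}{\mathrm{pr}(Y=y\mid Z=1)}\right).$$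
   Context: $Z\in\{0,1\}$ is a binary treatment, and $Y$ is an observed ordinal outcome with levels $0,\ldots,J-1$ ($J\ge 2$). $Y_1,Y_0\in\{0,\ldots,J-1\}$ are the potential outcomes under treatment and control, all on a common probability space, and $Y=Y_z$ on $\{Z=z\}$. The level $y\in\{0,\ldots,J-1\}$ satisfies $\mathrm{pr}(Z=1,Y=y)>0$, so that the conditional probability is defined. Write $q_{k\ell\mid 1}=\mathrm{pr}(Y_1=k,Y_0=\ell\mid Z=1)$, so that $\mathrm{PN}(\omega_0,y)=\sum_{\ell=0}^{J-1}c_\ell q_{y\ell\mid 1}/\mathrm{pr}(Y=y\mid Z=1)$. "Sharp" means: for the given marginals, the inequalities hold for every nonnegative matrix $(q_{k\ell\mid 1})_{k,\ell=0,\ldots,J-1}$ with row sums $\sum_{\ell}q_{k\ell\mid 1}=\mathrm{pr}(Y_1=k\mid Z=1)$ and column sums $\sum_{k}q_{k\ell\mid 1}=\mathrm{pr}(Y_0=\ell\mid Z=1)$, and each of the lower and upper bounds is attained by some such matrix. *)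

theory Defs
  imports "HOL-Probability.Probability"
begin

(* Treatment and outcomes are coded as natural numbers; measurability into the count space of
   the level set also says that the variable takes its values there. Z is not assumed to be
   independent of the potential outcomes. *)
locale potential_outcomes = prob_space M for M :: "'a measure" +
  fixes J :: nat and Z Y Y1 Y0 :: "'a \<Rightarrow> nat"
  assumes J_ge_2: "2 \<le> J"
    and Z_rv: "Z \<in> measurable M (count_space {0, 1})"
    and Y_rv: "Y \<in> measurable M (count_space {..<J})"
    and Y1_rv: "Y1 \<in> measurable M (count_space {..<J})"
    and Y0_rv: "Y0 \<in> measurable M (count_space {..<J})"
    and consistency1: "\<And>\<omega>. \<omega> \<in> space M \<Longrightarrow> Z \<omega> = 1 \<Longrightarrow> Y \<omega> = Y1 \<omega>"
    and consistency0: "\<And>\<omega>. \<omega> \<in> space M \<Longrightarrow> Z \<omega> = 0 \<Longrightarrow> Y \<omega> = Y0 \<omega>"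

definition PN :: "'a measure \<Rightarrow> ('a \<Rightarrow> nat) \<Rightarrow> ('a \<Rightarrow> nat) \<Rightarrow> 'a set \<Rightarrow> nat \<Rightarrow> real" where
  "PN M Z Y W y = \<P>(\<omega> in M. \<omega> \<in> W \<bar> Z \<omega> = 1 \<and> Y \<omega> = y)"

(* Only the entries with both indices below J matter; a matrix is a function whose other values
   are left free. *)
definition joint_matrices ::
    "nat \<Rightarrow> (nat \<Rightarrow> real) \<Rightarrow> (nat \<Rightarrow> real) \<Rightarrow> (nat \<Rightarrow> nat \<Rightarrow> real) set" where
  "joint_matrices J r s = {q.
     (\<forall>k<J. \<forall>l<J. 0 \<le> q k l) \<and>
     (\<forall>k<J. (\<Sum>l<J. q k l) = r k) \<and>
     (\<forall>l<J. (\<Sum>k<J. q k l) = s l)}"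

(* The value of PN for the event that Y0 lies in S when q is the joint distribution of (Y1, Y0)
   given Z = 1 and p is pr(Y = y | Z = 1); see PN_eq_PN_matrix below. *)
definition PN_matrix :: "nat \<Rightarrow> nat set \<Rightarrow> nat \<Rightarrow> real \<Rightarrow> (nat \<Rightarrow> nat \<Rightarrow> real) \<Rightarrow> real" where
  "PN_matrix J S y p q = (\<Sum>l<J. indicator S l * q y l) / p"

definition sharp_bounds :: "'q set \<Rightarrow> ('q \<Rightarrow> real) \<Rightarrow> real \<Rightarrow> real \<Rightarrow> bool" where
  "sharp_bounds Q f lo hi \<longleftrightarrow>
     (\<forall>q\<in>Q. lo \<le> f q \<and> f q \<le> hi) \<and> (\<exists>q\<in>Q. f q = lo) \<and> (\<exists>q\<in>Q. f q = hi)"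

context potential_outcomes
begin

lemma measurable_nat [measurable]:
  "Z \<in> measurable M (count_space UNIV)" "Y \<in> measurable M (count_space UNIV)"
  "Y1 \<in> measurable M (count_space UNIV)" "Y0 \<in> measurable M (count_space UNIV)"
  by (rule measurable_compose[OF Z_rv] measurable_compose[OF Y_rv]
      measurable_compose[OF Y1_rv] measurable_compose[OF Y0_rv]; simp)+

lemma outcome_less:
  "\<omega> \<in> space M \<Longrightarrow> Y1 \<omega> < J" "\<omega> \<in> space M \<Longrightarrow> Y0 \<omega> < J"
  using measurable_space[OF Y1_rv] measurable_space[OF Y0_rv] by auto

lemma prob_sum_levels:
  fixes V :: "'a \<Rightarrow> nat"
  assumes [measurable]: "V \<in> measurable M (count_space UNIV)" "Measurable.pred M P"
  shows "(\<Sum>l\<in>A \<inter> {..<J}. \<P>(\<omega> in M. V \<omega> = l \<and> P \<omega>)) = \<P>(\<omega> in M. V \<omega> \<in> A \<inter> {..<J} \<and> P \<omega>)"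
proof -
  have "\<P>(\<omega> in M. V \<omega> \<in> A \<inter> {..<J} \<and> P \<omega>) =
      prob (\<Union>l\<in>A \<inter> {..<J}. {\<omega> \<in> space M. V \<omega> = l \<and> P \<omega>})"
    by (rule arg_cong[where f = prob]) auto
  also have "\<dots> = (\<Sum>l\<in>A \<inter> {..<J}. \<P>(\<omega> in M. V \<omega> = l \<and> P \<omega>))"
    by (rule finite_measure_finite_Union) (auto simp: disjoint_family_on_def)
  finally show ?thesis ..
qed

lemma joint_in_joint_matrices:
  "(\<lambda>k l. \<P>(\<omega> in M. Y1 \<omega> = k \<and> Y0 \<omega> = l \<bar> Z \<omega> = 1)) \<in>
     joint_matrices J (\<lambda>k. \<P>(\<omega> in M. Y1 \<omega> = k \<bar> Z \<omega> = 1)) (\<lambda>l. \<P>(\<omega> in M. Y0 \<omega> = l \<bar> Z \<omega> = 1))"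
proof -
  have "(\<Sum>l<J. \<P>(\<omega> in M. (Y1 \<omega> = k \<and> Y0 \<omega> = l) \<and> Z \<omega> = 1)) = \<P>(\<omega> in M. Y1 \<omega> = k \<and> Z \<omega> = 1)" for k
  proof -
    have "\<P>(\<omega> in M. Y0 \<omega> \<in> UNIV \<inter> {..<J} \<and> Y1 \<omega> = k \<and> Z \<omega> = 1) = \<P>(\<omega> in M. Y1 \<omega> = k \<and> Z \<omega> = 1)"
      by (rule arg_cong[where f = prob]) (auto simp: outcome_less)
    then show ?thesis
      using prob_sum_levels[of Y0 "\<lambda>\<omega>. Y1 \<omega> = k \<and> Z \<omega> = 1" UNIV] by (simp add: conj_ac)
  qed
  moreover have "(\<Sum>k<J. \<P>(\<omega> in M. (Y1 \<omega> = k \<and> Y0 \<omega> = l) \<and> Z \<omega> = 1)) = \<P>(\<omega> in M. Y0 \<omega> = l \<and> Z \<omega> = 1)" for l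
  proof -
    have "\<P>(\<omega> in M. Y1 \<omega> \<in> UNIV \<inter> {..<J} \<and> Y0 \<omega> = l \<and> Z \<omega> = 1) = \<P>(\<omega> in M. Y0 \<omega> = l \<and> Z \<omega> = 1)"
      by (rule arg_cong[where f = prob]) (auto simp: outcome_less)
    then show ?thesis
      using prob_sum_levels[of Y1 "\<lambda>\<omega>. Y0 \<omega> = l \<and> Z \<omega> = 1" UNIV] by (simp add: conj_ac)
  qed
  ultimately show ?thesis
    by (auto simp: joint_matrices_def cond_prob_def simp flip: sum_divide_distrib)
qed

lemma PN_eq_PN_matrix:
  assumes "0 < \<P>(\<omega> in M. Z \<omega> = 1 \<and> Y \<omega> = y)"
  shows "PN M Z Y {\<omega> \<in> space M. Y0 \<omega> \<in> S} y =
    PN_matrix J S y \<P>(\<omega> in M. Y \<omega> = y \<bar> Z \<omega> = 1)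
      (\<lambda>k l. \<P>(\<omega> in M. Y1 \<omega> = k \<and> Y0 \<omega> = l \<bar> Z \<omega> = 1))"
proof -
  have pos: "0 < \<P>(\<omega> in M. Z \<omega> = 1)"
    using assms by (rule less_le_trans) (auto intro!: finite_measure_mono)
  have "(\<Sum>l<J. indicator S l * \<P>(\<omega> in M. (Y1 \<omega> = y \<and> Y0 \<omega> = l) \<and> Z \<omega> = 1)) =
      (\<Sum>l\<in>S \<inter> {..<J}. \<P>(\<omega> in M. Y0 \<omega> = l \<and> Y1 \<omega> = y \<and> Z \<omega> = 1))"
    by (rule sum.mono_neutral_cong_right) (auto simp: indicator_def conj_ac)
  also have "\<dots> = \<P>(\<omega> in M. Y0 \<omega> \<in> S \<inter> {..<J} \<and> Y1 \<omega> = y \<and> Z \<omega> = 1)"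
    by (rule prob_sum_levels) auto
  also have "\<dots> = \<P>(\<omega> in M. \<omega> \<in> {\<omega> \<in> space M. Y0 \<omega> \<in> S} \<and> Z \<omega> = 1 \<and> Y \<omega> = y)"
    by (rule arg_cong[where f = prob]) (auto simp: outcome_less consistency1)
  finally show ?thesis
    using pos by (simp add: PN_def PN_matrix_def cond_prob_def conj_ac flip: sum_divide_distrib)
qed

end

end

theory Submission
  imports Defs
begin

text \<open>
  Only row \<open>y\<close> of the matrix matters, and a vector \<open>v\<close> is such a row iff \<open>0 \<le> v \<le> s\<close> and its
  entries sum to \<open>r y\<close>: the remaining mass can be spread over the other rows as a product of the
  remaining marginals. Scaling \<open>s\<close> separately on \<open>S\<close> and off \<open>S\<close> gives such a vector with any mass
  on \<open>S\<close> that the obvious inequalities allow, in particular with the extremal ones.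
\<close>

lemma joint_matrix_with_row:
  fixes r s v :: "nat \<Rightarrow> real"
  assumes y: "y < J"
    and r: "\<And>k. k < J \<Longrightarrow> 0 \<le> r k"
    and total: "(\<Sum>k<J. r k) = (\<Sum>l<J. s l)"
    and v: "\<And>l. l < J \<Longrightarrow> 0 \<le> v l" "\<And>l. l < J \<Longrightarrow> v l \<le> s l"
    and v_sum: "(\<Sum>l<J. v l) = r y"
  obtains q where "q \<in> joint_matrices J r s" "q y = v"
proof -
  \<comment> \<open>\<open>D\<close> is the mass left outside row \<open>y\<close>. The leftover row
    sums \<open>r k\<close> with \<open>k \<noteq> y\<close> and the leftover column sums
    \<open>s l - v l\<close> both add up to \<open>D\<close>, so their product divided by
    \<open>D\<close> has the right marginals.\<close>
  define D where "D = (\<Sum>l<J. s l - v l)"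
  define q where "q = (\<lambda>k l. if k = y then v l else r k * (s l - v l) / D)"
  have D_nonneg: "0 \<le> D"
    unfolding D_def by (rule sum_nonneg) (simp add: v)
  have rest: "(\<Sum>k\<in>{..<J} - {y}. r k) = D"
    using y by (simp add: D_def sum_subtractf sum_diff1 total v_sum)
  have nonneg: "0 \<le> q k l" if "k < J" "l < J" for k l
    using that D_nonneg by (simp add: q_def r v)
  have row: "(\<Sum>l<J. q k l) = r k" if "k < J" for k
  proof (cases "k = y")
    case True
    then show ?thesis by (simp add: q_def v_sum)
  next
    case False
    then have "(\<Sum>l<J. q k l) = r k * D / D"
      by (simp add: q_def D_def sum_distrib_left sum_divide_distrib)
    \<comment> \<open>Division by \<open>D = 0\<close> yields \<open>0\<close>, which is correct:
      nonnegative leftover row sums with total \<open>0\<close> all vanish. The columns are treated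
      in the same way.\<close>
    moreover have "r k = 0" if "D = 0"
      using sum_nonneg_0[of "{..<J} - {y}" r k] rest that \<open>k < J\<close> False r by simp
    ultimately show ?thesis by (cases "D = 0") auto
  qed
  have col: "(\<Sum>k<J. q k l) = s l" if "l < J" for l
  proof -
    have "(\<Sum>k<J. q k l) = v l + (\<Sum>k\<in>{..<J} - {y}. r k * (s l - v l) / D)"
      using y by (simp add: q_def sum.remove[of _ y])
    also have "\<dots> = v l + D * (s l - v l) / D"
      by (simp add: sum_distrib_right flip: rest sum_divide_distrib)
    moreover have "s l = v l" if "D = 0"
      using sum_nonneg_0[of "{..<J}" "\<lambda>l. s l - v l" l] that \<open>l < J\<close> v by (simp add: D_def)
    ultimately show ?thesis by (cases "D = 0") auto
  qed
  have "q \<in> joint_matrices J r s"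
    using nonneg row col by (simp add: joint_matrices_def)
  moreover have "q y = v"
    by (simp add: q_def)
  ultimately show ?thesis ..
qed

text \<open>The four conditions on \<open>t\<close> place the scaling factors \<open>t / a\<close>
  on \<open>S\<close> and \<open>(r y - t) / b\<close> off \<open>S\<close> between 0 and 1.\<close>

lemma joint_matrix_with_row_mass:
  fixes r s :: "nat \<Rightarrow> real" and S :: "nat set" and t :: real and J y :: nat
  defines "a \<equiv> \<Sum>l<J. indicator S l * s l" and "b \<equiv> \<Sum>l<J. (1 - indicator S l) * s l"
  assumes y: "y < J"
    and r: "\<And>k. k < J \<Longrightarrow> 0 \<le> r k" and s: "\<And>l. l < J \<Longrightarrow> 0 \<le> s l"
    and total: "(\<Sum>k<J. r k) = (\<Sum>l<J. s l)"
    and t: "0 \<le> t" "t \<le> r y" "t \<le> a" "r y - t \<le> b"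
  obtains q where "q \<in> joint_matrices J r s" "(\<Sum>l<J. indicator S l * q y l) = t"
proof -
  \<comment> \<open>If \<open>a = 0\<close> or \<open>b = 0\<close>, division yields \<open>0\<close>, which is the right value since then
    \<open>t = 0\<close> or \<open>t = r y\<close>.\<close>
  define \<alpha> \<beta> where "\<alpha> = t / a" and "\<beta> = (r y - t) / b"
  have ab: "\<alpha> * a = t" "\<beta> * b = r y - t"
    using t by (auto simp: \<alpha>_def \<beta>_def)
  have range: "0 \<le> \<alpha>" "\<alpha> \<le> 1" "0 \<le> \<beta>" "\<beta> \<le> 1"
    using t by (auto simp: \<alpha>_def \<beta>_def divide_le_eq_1)
  define v where "v = (\<lambda>l. \<alpha> * (indicator S l * s l) + \<beta> * ((1 - indicator S l) * s l))"
  have v_sum: "(\<Sum>l<J. v l) = r y"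
    using ab by (simp add: v_def a_def b_def sum.distrib flip: sum_distrib_left)
  \<comment> \<open>For each \<open>l\<close> only one summand of \<open>v l\<close> survives, so
    \<open>v l\<close> is \<open>\<alpha> * s l\<close> or \<open>\<beta> * s l\<close>.\<close>
  have v_nonneg: "0 \<le> v l" and v_le: "v l \<le> s l" if "l < J" for l
    using range s[OF that] by (auto simp: v_def indicator_def mult_left_le_one_le)
  obtain q where q: "q \<in> joint_matrices J r s" "q y = v"
    using joint_matrix_with_row[OF y r total v_nonneg v_le v_sum] by blast
  have "(\<Sum>l<J. indicator S l * v l) = (\<Sum>l<J. \<alpha> * (indicator S l * s l))"
    by (rule sum.cong) (auto simp: v_def indicator_def)
  also have "\<dots> = t"
    using ab by (simp add: a_def flip: sum_distrib_left)
  finally show ?thesis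
    using that q by simp
qed

text \<open>An entry of row \<open>y\<close> is at most its column sum. Summing over
  \<open>S\<close> bounds the mass on \<open>S\<close> from above; summing off \<open>S\<close> and
  subtracting from \<open>r y\<close> bounds it from below. Conversely,
  \<open>joint_matrix_with_row_mass\<close> attains every mass within these four bounds.\<close>

lemma row_mass_bounds:
  fixes r s :: "nat \<Rightarrow> real" and S :: "nat set"
  assumes y: "y < J" and q: "q \<in> joint_matrices J r s"
  shows "0 \<le> (\<Sum>l<J. indicator S l * q y l)"
    and "(\<Sum>l<J. indicator S l * q y l) \<le> r y"
    and "(\<Sum>l<J. indicator S l * q y l) \<le> (\<Sum>l<J. indicator S l * s l)"
    and "r y - (\<Sum>l<J. (1 - indicator S l) * s l) \<le> (\<Sum>l<J. indicator S l * q y l)"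
proof -
  have nonneg: "0 \<le> q k l" if "k < J" "l < J" for k l
    using q that by (simp add: joint_matrices_def)
  have row: "(\<Sum>l<J. q y l) = r y"
    using q y by (simp add: joint_matrices_def)
  have le: "q y l \<le> s l" if "l < J" for l
  proof -
    have "q y l \<le> (\<Sum>k<J. q k l)"
      using y that nonneg by (intro member_le_sum) auto
    then show ?thesis
      using q that by (simp add: joint_matrices_def)
  qed
  show "0 \<le> (\<Sum>l<J. indicator S l * q y l)"
    by (rule sum_nonneg) (simp add: nonneg y)
  show "(\<Sum>l<J. indicator S l * q y l) \<le> r y"
    unfolding row[symmetric] by (rule sum_mono) (simp add: nonneg y indicator_def)
  show "(\<Sum>l<J. indicator S l * q y l) \<le> (\<Sum>l<J. indicator S l * s l)"
    by (rule sum_mono) (simp add: le indicator_def)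
  have "(\<Sum>l<J. (1 - indicator S l) * q y l) \<le> (\<Sum>l<J. (1 - indicator S l) * s l)"
    by (rule sum_mono) (simp add: le indicator_def)
  then show "r y - (\<Sum>l<J. (1 - indicator S l) * s l) \<le> (\<Sum>l<J. indicator S l * q y l)"
    by (simp add: left_diff_distrib sum_subtractf row)
qed

lemma sharp_bounds_PN_matrix:
  fixes r s :: "nat \<Rightarrow> real"
  assumes y: "y < J" and pos: "0 < r y"
    and r: "\<And>k. k < J \<Longrightarrow> 0 \<le> r k" and s: "\<And>l. l < J \<Longrightarrow> 0 \<le> s l"
    and total: "(\<Sum>k<J. r k) = (\<Sum>l<J. s l)"
  shows "sharp_bounds (joint_matrices J r s) (PN_matrix J S y (r y))
    (max 0 ((r y - (\<Sum>l<J. (1 - indicator S l) * s l)) / r y))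
    (min 1 ((\<Sum>l<J. indicator S l * s l) / r y))"
proof -
  define a where "a = (\<Sum>l<J. indicator S l * s l)"
  define b where "b = (\<Sum>l<J. (1 - indicator S l) * s l)"
  have a: "0 \<le> a" and b: "0 \<le> b"
    unfolding a_def b_def by (auto intro!: sum_nonneg simp: s indicator_def)
  \<comment> \<open>The resulting \<open>r y - b \<le> a\<close> keeps the lower endpoint from
    exceeding the upper one, so that both endpoints are attainable masses.\<close>
  have "r y \<le> (\<Sum>k<J. r k)"
    using y r by (intro member_le_sum) auto
  also have "\<dots> = a + b"
    unfolding total a_def b_def by (simp add: left_diff_distrib sum_subtractf)
  finally have ab: "r y \<le> a + b" .
  have lo: "max 0 ((r y - b) / r y) = max 0 (r y - b) / r y"
    and hi: "min 1 (a / r y) = min (r y) a / r y"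
    using pos by (auto simp: max_def min_def field_simps)
  have "max 0 (r y - b) / r y \<le> PN_matrix J S y (r y) q \<and>
      PN_matrix J S y (r y) q \<le> min (r y) a / r y"
    if q: "q \<in> joint_matrices J r s" for q
    using row_mass_bounds[OF y q, of S] pos
    by (simp add: PN_matrix_def divide_right_mono flip: a_def b_def)
  \<comment> \<open>Attainment is needed for \<open>t = max 0 (r y - b)\<close> and
    \<open>t = min (r y) a\<close>.\<close>
  moreover have "\<exists>q\<in>joint_matrices J r s. PN_matrix J S y (r y) q = t / r y"
    if "0 \<le> t" "t \<le> r y" "t \<le> a" "r y - t \<le> b" for t
    using joint_matrix_with_row_mass[OF y r s total that[unfolded a_def b_def]]
    by (metis PN_matrix_def)
  ultimately show ?thesis
    using a b ab pos unfolding sharp_bounds_def a_def[symmetric] b_def[symmetric] lo hi by auto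
qed

theorem theorem2:
  fixes M :: "'a measure" and J y :: nat and Z Y Y1 Y0 :: "'a \<Rightarrow> nat" and S :: "nat set"
  assumes model: "potential_outcomes M J Z Y Y1 Y0"
    and S: "S \<subseteq> {0..J-1}"
    and y: "y \<in> {0..J-1}"
    and pos: "0 < \<P>(\<omega> in M. Z \<omega> = 1 \<and> Y \<omega> = y)"
  defines "c \<equiv> \<lambda>l. indicator S l :: real"
    and "p \<equiv> \<P>(\<omega> in M. Y \<omega> = y \<bar> Z \<omega> = 1)"
    and "r \<equiv> \<lambda>k. \<P>(\<omega> in M. Y1 \<omega> = k \<bar> Z \<omega> = 1)"
    and "s \<equiv> \<lambda>l. \<P>(\<omega> in M. Y0 \<omega> = l \<bar> Z \<omega> = 1)"
  defines "lower \<equiv> max 0 ((p - (\<Sum>l=0..J-1. (1 - c l) * s l)) / p)"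
    and "upper \<equiv> min 1 ((\<Sum>l=0..J-1. c l * s l) / p)"
  shows "lower \<le> PN M Z Y {\<omega> \<in> space M. Y0 \<omega> \<in> S} y \<and>
    PN M Z Y {\<omega> \<in> space M. Y0 \<omega> \<in> S} y \<le> upper \<and>
    sharp_bounds (joint_matrices J r s) (PN_matrix J S y p) lower upper"
proof -
  interpret potential_outcomes M J Z Y Y1 Y0
    by (fact model)
  let ?q = "\<lambda>k l. \<P>(\<omega> in M. Y1 \<omega> = k \<and> Y0 \<omega> = l \<bar> Z \<omega> = 1)"
  have levels: "{0..J-1} = {..<J}"
    using J_ge_2 by auto
  \<comment> \<open>By consistency \<open>Y\<close> and \<open>Y1\<close> agree where
    \<open>Z\<close> is 1, so the observed \<open>p\<close> is the sum of row
    \<open>y\<close>.\<close>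
  have p_eq: "p = r y"
    unfolding p_def r_def cond_prob_def
    by (intro arg_cong2[where f = "(/)"] arg_cong[where f = prob]) (auto simp: consistency1)
  have "0 < \<P>(\<omega> in M. Z \<omega> = 1)"
    using pos by (rule less_le_trans) (auto intro!: finite_measure_mono)
  then have p_pos: "0 < p"
    using pos by (simp add: p_def cond_prob_def conj_commute)
  have q: "?q \<in> joint_matrices J r s"
    unfolding r_def s_def by (rule joint_in_joint_matrices)
  \<comment> \<open>Both marginals come from the true joint law \<open>?q\<close>, so their totals
    agree after exchanging the sums.\<close>
  have "(\<Sum>k<J. r k) = (\<Sum>k<J. \<Sum>l<J. ?q k l)" "(\<Sum>l<J. s l) = (\<Sum>l<J. \<Sum>k<J. ?q k l)"
    using q by (simp_all add: joint_matrices_def)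
  then have total: "(\<Sum>k<J. r k) = (\<Sum>l<J. s l)"
    using sum.swap[of ?q "{..<J}" "{..<J}"] by simp
  have "sharp_bounds (joint_matrices J r s) (PN_matrix J S y p) lower upper"
  proof -
    have "y < J"
      using y by (simp only: levels lessThan_iff)
    moreover have "0 < r y"
      using p_pos by (simp only: p_eq)
    ultimately have "sharp_bounds (joint_matrices J r s) (PN_matrix J S y (r y))
        (max 0 ((r y - (\<Sum>l<J. (1 - indicator S l) * s l)) / r y))
        (min 1 ((\<Sum>l<J. indicator S l * s l) / r y))"
      by (rule sharp_bounds_PN_matrix) (simp_all add: total, simp_all add: r_def s_def cond_prob_def)
    then show ?thesis
      by (simp only: lower_def upper_def c_def levels p_eq)
  qed
  \<comment> \<open>The true joint law is one of the admissible matrices, so the bounds on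
    \<open>PN\<close> are an instance of the sharp ones.\<close>
  moreover have "PN M Z Y {\<omega> \<in> space M. Y0 \<omega> \<in> S} y = PN_matrix J S y p ?q"
    unfolding p_def by (rule PN_eq_PN_matrix[OF pos])
  ultimately show ?thesis
    using q by (simp add: sharp_bounds_def)
qed

end
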